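(* Let $(V,D,C)$ be a constraint satisfaction problem with a dominance relation $\preceq$, and let $\mathcal{S}$ be the set of all solutions of $(V,D,C)$. Then the set $A$ returned by the equivalence-free dominance search algorithm (described in the context) on input $(V,D,C,\preceq)$ is complete, i.e. for every $X\in\mathcal{S}$ there exists $Y\in A$ with $Y\preceq X$, and equivalence-free, i.e. $X\nsim Y$ for all distinct $X,Y\in A$.
   Context: A constraint satisfaction problem (CSP) is a triple $(V,D,C)$, where $V$ is a set of variables, $D$ maps each variable $v$ to a set of values $D(v)$, and $C$ is a set of constraints (arbitrary relations over subsets of $V$). A solution is an assignment $X$ with $X(v)\in D(v)$ for every $v\in V$ that satisfies every constraint in $C$. A dominance relation $\preceq$ is a preorder (reflexive and transitive relation) on the set of solutions; $X\sim Y$ means $X\preceq Y$ and $Y\preceq X$. Equivalence-free dominance search algorithm: start with $A:=\emptyset$ and with $C$ the given constraint set. Repeat: call an oracle on the current CSP $(V,D,C)$; the oracle returns an (arbitrary) solution of the current CSP, or fails if no solution exists. If it returns a solution $S$, put $A:=A\cup\{S\}$ and add to $C$ the constraint "$S\not\preceq V$", i.e. the constraint satisfied by exactly those assignments $X$ with $S\not\preceq X$. If the oracle fails, stop and return $A$. The statement concerns the set $A$ returned when the algorithm stops (after finitely many oracle calls). *)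

theory Defs
  imports Main "HOL-Library.FuncSet"
begin

type_synonym ('v, 'a) assignment = "'v \<Rightarrow> 'a"

text \<open>A constraint is a scope together with the set of assignments of that scope that it
  allows. An assignment of a set \<open>U\<close> of variables is a function in \<open>extensional U\<close>,
  so that equality of functions is equality of assignments.\<close>

type_synonym ('v, 'a) constraint = "'v set \<times> ('v, 'a) assignment set"

record ('v, 'a) csp =
  vars :: "'v set"
  dom_of :: "'v \<Rightarrow> 'a set"
  constraints :: "('v, 'a) constraint set"

definition is_csp :: "('v, 'a) csp \<Rightarrow> bool" where
  "is_csp P \<longleftrightarrow> (\<forall>(U, R) \<in> constraints P. U \<subseteq> vars P \<and> R \<subseteq> extensional U)"

definition satisfies :: "('v, 'a) assignment \<Rightarrow> ('v, 'a) constraint \<Rightarrow> bool" where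
  "satisfies X c \<longleftrightarrow> restrict X (fst c) \<in> snd c"

definition solutions :: "('v, 'a) csp \<Rightarrow> ('v, 'a) assignment set" where
  "solutions P = {X \<in> PiE (vars P) (dom_of P). \<forall>c \<in> constraints P. satisfies X c}"

text \<open>A dominance relation is given as the set \<open>r\<close> of pairs \<open>(X, Y)\<close> such that
  \<open>X\<close> precedes \<open>Y\<close>.\<close>

definition dominance_relation ::
  "('v, 'a) csp \<Rightarrow> (('v, 'a) assignment \<times> ('v, 'a) assignment) set \<Rightarrow> bool" where
  "dominance_relation P r \<longleftrightarrow> preorder_on (solutions P) r"

definition dom_equiv :: "('s \<times> 's) set \<Rightarrow> 's \<Rightarrow> 's \<Rightarrow> bool" where
  "dom_equiv r X Y \<longleftrightarrow> (X, Y) \<in> r \<and> (Y, X) \<in> r"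

definition not_dominated_by ::
  "'v set \<Rightarrow> (('v, 'a) assignment \<times> ('v, 'a) assignment) set \<Rightarrow> ('v, 'a) assignment
    \<Rightarrow> ('v, 'a) constraint" where
  "not_dominated_by W r S = (W, {X \<in> extensional W. (S, X) \<notin> r})"

definition add_constraint ::
  "('v, 'a) constraint \<Rightarrow> ('v, 'a) csp \<Rightarrow> ('v, 'a) csp" where
  "add_constraint c P = P\<lparr>constraints := insert c (constraints P)\<rparr>"

text \<open>One successful oracle call, on states consisting of the accumulated set and the current
  problem. The oracle may return any solution, so the step is a nondeterministic relation.\<close>

inductive search_step ::
  "(('v, 'a) assignment \<times> ('v, 'a) assignment) set
    \<Rightarrow> ('v, 'a) assignment set \<times> ('v, 'a) csp
    \<Rightarrow> ('v, 'a) assignment set \<times> ('v, 'a) csp \<Rightarrow> bool"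
  for r where
  "S \<in> solutions P \<Longrightarrow>
    search_step r (A, P) (A \<union> {S}, add_constraint (not_dominated_by (vars P) r S) P)"

text \<open>\<open>A\<close> is the output of some terminating run: finitely many successful oracle calls,
  followed by one that fails.\<close>

definition search_returns ::
  "('v, 'a) csp \<Rightarrow> (('v, 'a) assignment \<times> ('v, 'a) assignment) set
    \<Rightarrow> ('v, 'a) assignment set \<Rightarrow> bool" where
  "search_returns P r A \<longleftrightarrow>
    (\<exists>Q. (search_step r)\<^sup>*\<^sup>* ({}, P) (A, Q) \<and> solutions Q = {})"

definition complete_for :: "('s \<times> 's) set \<Rightarrow> 's set \<Rightarrow> 's set \<Rightarrow> bool" where
  "complete_for r \<S> A \<longleftrightarrow> (\<forall>X \<in> \<S>. \<exists>Y \<in> A. (Y, X) \<in> r)"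

definition equivalence_free :: "('s \<times> 's) set \<Rightarrow> 's set \<Rightarrow> bool" where
  "equivalence_free r A \<longleftrightarrow> (\<forall>X \<in> A. \<forall>Y \<in> A. X \<noteq> Y \<longrightarrow> \<not> dom_equiv r X Y)"

end

theory Submission
  imports Defs
begin

(* Throughout a run, the solutions of the current problem are exactly the original solutions
   that no element of the accumulated set precedes. A failing oracle call therefore
   means completeness. An added solution is preceded by no earlier one, and equivalence of two
   elements would need both directions, so the set stays equivalence-free. *)

text \<open>Members of \<open>PiE (vars P) (dom_of P)\<close> are extensional on
  \<open>vars P\<close>, so restricting them to the full scope changes nothing: the new constraint
  tests the assignment itself.\<close>

lemma solutions_add_not_dominated_by:
  "solutions (add_constraint (not_dominated_by (vars P) r S) P) = {X \<in> solutions P. (S, X) \<notin> r}"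
proof -
  have "satisfies X (not_dominated_by (vars P) r S) \<longleftrightarrow> (S, X) \<notin> r"
    if "X \<in> PiE (vars P) (dom_of P)" for X
    using that by (auto simp: satisfies_def not_dominated_by_def PiE_restrict PiE_iff extensional_restrict)
  then show ?thesis
    by (auto simp: solutions_def add_constraint_def)
qed

lemma equivalence_free_insert:
  assumes "equivalence_free r A" and "\<forall>Y \<in> A. (Y, S) \<notin> r"
  shows "equivalence_free r (insert S A)"
  using assms by (auto simp: equivalence_free_def dom_equiv_def)

text \<open>Both claims go through one induction, since preserving the second relies on the
  first.\<close>

lemma search_invariant:
  assumes "(search_step r)\<^sup>*\<^sup>* ({}, P) (A, Q)"
  shows "solutions Q = {X \<in> solutions P. \<forall>S \<in> A. (S, X) \<notin> r} \<and> equivalence_free r A"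
  using assms
proof (induction rule: rtranclp_induct2)
  case refl
  then show ?case by (simp add: equivalence_free_def)
next
  case (step A Q A' Q')
  from step.hyps(2) obtain S where "S \<in> solutions Q" and A': "A' = insert S A"
    and Q': "Q' = add_constraint (not_dominated_by (vars Q) r S) Q"
    by (auto elim: search_step.cases)
  \<comment> \<open>As \<open>S\<close> solves \<open>Q\<close>, the description of
    \<open>solutions Q\<close> shows that no member of \<open>A\<close> precedes
    \<open>S\<close>.\<close>
  with step.IH have "equivalence_free r A'"
    by (simp add: equivalence_free_insert)
  with step.IH show ?case
    by (auto simp: A' Q' solutions_add_not_dominated_by)
qed

theorem mainTheorem4:
  fixes P :: "('v, 'a) csp"
    and r :: "(('v, 'a) assignment \<times> ('v, 'a) assignment) set"
    and A :: "('v, 'a) assignment set"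
  assumes "is_csp P"
    and "dominance_relation P r"
    and "search_returns P r A"
  shows "complete_for r (solutions P) A \<and> equivalence_free r A"
proof -
  from assms(3) obtain Q where "(search_step r)\<^sup>*\<^sup>* ({}, P) (A, Q)" and "solutions Q = {}"
    unfolding search_returns_def by blast
  with search_invariant[of r P A Q] show ?thesis
    unfolding complete_for_def by blast
qed

end
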